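(* Let $(G,b,m)$, $G=(V_G,\vec E_G)$, be a finite connected weighted directed graph satisfying the standing assumptions in the context, with $\#V_G=n$, and let $H=(V_H,\vec E_H)$ be a connected subgraph of $G$ with $\#V_H=r$. Then for every $1\le k\le r$, $$\lambda_k(S^D_H)\le\lambda_{k+n-r}(S_G).$$
   Context: Setting. $G=(V,\vec E)$ is a directed graph with $V$ a finite nonempty set and $\vec E\subset V\times V$; $b:V\times V\to[0,\infty)$ satisfies $b(x,x)=0$ for all $x$ and $b(x,y)>0$ iff $(x,y)\in\vec E$; $m:V\to(0,\infty)$. Put $V_x^+=\{y:(x,y)\in\vec E\}$, $V_x^-=\{y:(y,x)\in\vec E\}$, $V_x=V_x^+\cup V_x^-$. A graph is connected if any two distinct vertices are joined by a directed path from one of them to the other. Standing assumptions on $G$: (i) connected; (ii) $V_x^+\ne\emptyset$ and $V_x^-\neq\emptyset$ for all $x$; (iii) Assumption $(\beta)$: $\sum_{y\in V_x^+}b(x,y)=\sum_{y\in V_x^-}b(y,x)$ for all $x\in V$. Functions $f:V\to\mathbb C$ carry the inner product $(f,g)_m=\sum_{x}m(x)f(x)\overline{g(x)}$. With $a(x,y)=b(x,y)+b(y,x)$, the special Laplacian is the self-adjoint operator $S_Gf(x)=\frac1{m(x)}\sum_{y\in V_x}a(x,y)(f(x)-f(y))$. A subgraph $H=(V_H,\vec E_H)$ of $G$ is an induced one: $V_H\subset V_G$ and $\vec E_H=(V_H\times V_H)\cap\vec E_G$. The Dirichlet operator $S^D_H$ acts on functions $f$ on $V_G$ supported in $V_H$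 by $S^D_Hf=(S_Gf)|_{V_H}$. Eigenvalues are listed in nondecreasing order with multiplicity: $\lambda_1\le\lambda_2\le\cdots$. *)

theory Defs
  imports "HOL-Analysis.Analysis"
begin

text \<open>
  The vertex set of \<open>G\<close> is a finite type \<open>'v\<close>, so functions on \<open>V_G\<close> are the vectors of type
  \<^typ>\<open>complex ^ 'v\<close>; vertex sets of subgraphs are sets over \<open>'v\<close>.
\<close>

definition out_nbrs :: "('v \<times> 'v) set \<Rightarrow> 'v \<Rightarrow> 'v set" where
  "out_nbrs E x = {y. (x, y) \<in> E}"

definition in_nbrs :: "('v \<times> 'v) set \<Rightarrow> 'v \<Rightarrow> 'v set" where
  "in_nbrs E x = {y. (y, x) \<in> E}"

definition nbrs :: "('v \<times> 'v) set \<Rightarrow> 'v \<Rightarrow> 'v set" where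
  "nbrs E x = out_nbrs E x \<union> in_nbrs E x"

text \<open>A path in one of the two directions suffices; this is not strong connectedness.\<close>

definition connected_digraph :: "'v set \<Rightarrow> ('v \<times> 'v) set \<Rightarrow> bool" where
  "connected_digraph V E \<longleftrightarrow>
     (\<forall>x\<in>V. \<forall>y\<in>V. x \<noteq> y \<longrightarrow> (x, y) \<in> E\<^sup>+ \<or> (y, x) \<in> E\<^sup>+)"

definition induced_edges :: "('v \<times> 'v) set \<Rightarrow> 'v set \<Rightarrow> ('v \<times> 'v) set" where
  "induced_edges E VH = (VH \<times> VH) \<inter> E"

locale weighted_digraph =
  fixes E :: "('v::finite \<times> 'v) set"
    and b :: "'v \<Rightarrow> 'v \<Rightarrow> real"
    and m :: "'v \<Rightarrow> real"
  assumes b_nonneg: "b x y \<ge> 0"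
    and b_diag: "b x x = 0"
    and b_pos_iff: "b x y > 0 \<longleftrightarrow> (x, y) \<in> E"
    and m_pos: "m x > 0"

locale standing_weighted_digraph = weighted_digraph E b m
  for E :: "('v::finite \<times> 'v) set" and b :: "'v \<Rightarrow> 'v \<Rightarrow> real" and m :: "'v \<Rightarrow> real" +
  assumes connected: "connected_digraph UNIV E"
    and out_nonempty: "out_nbrs E x \<noteq> {}"
    and in_nonempty: "in_nbrs E x \<noteq> {}"
    and beta: "(\<Sum>y\<in>out_nbrs E x. b x y) = (\<Sum>y\<in>in_nbrs E x. b y x)"

definition sym_weight :: "('v \<Rightarrow> 'v \<Rightarrow> real) \<Rightarrow> 'v \<Rightarrow> 'v \<Rightarrow> real" where
  "sym_weight b x y = b x y + b y x"

definition special_laplacian ::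
  "('v::finite \<times> 'v) set \<Rightarrow> ('v \<Rightarrow> 'v \<Rightarrow> real) \<Rightarrow> ('v \<Rightarrow> real) \<Rightarrow> complex ^ 'v \<Rightarrow> complex ^ 'v" where
  "special_laplacian E b m f =
     (\<chi> x. complex_of_real (1 / m x) *
        (\<Sum>y\<in>nbrs E x. complex_of_real (sym_weight b x y) * (f $ x - f $ y)))"

definition supported_in :: "'v::finite set \<Rightarrow> (complex ^ 'v) set" where
  "supported_in VH = {f. \<forall>x. x \<notin> VH \<longrightarrow> f $ x = 0}"

text \<open>
  A function on \<open>VH\<close> is identified with its extension by zero, so that the Dirichlet operator is
  an endomorphism of \<^term>\<open>supported_in VH\<close>.
\<close>

definition dirichlet_laplacian ::
  "('v::finite \<times> 'v) set \<Rightarrow> ('v \<Rightarrow> 'v \<Rightarrow> real) \<Rightarrow> ('v \<Rightarrow> real) \<Rightarrow> 'v set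
     \<Rightarrow> complex ^ 'v \<Rightarrow> complex ^ 'v" where
  "dirichlet_laplacian E b m VH f =
     (\<chi> x. if x \<in> VH then special_laplacian E b m f $ x else 0)"

text \<open>
  For an operator \<open>T\<close> on a subspace \<open>W\<close>, each real eigenvalue is listed as often as the complex
  dimension of its eigenspace.  The operators considered here are self-adjoint (see below), so
  all their eigenvalues are real and geometric and algebraic multiplicities agree.
\<close>

definition eigenspace ::
  "(complex ^ 'v::finite) set \<Rightarrow> (complex ^ 'v \<Rightarrow> complex ^ 'v) \<Rightarrow> real \<Rightarrow> (complex ^ 'v) set" where
  "eigenspace W T l = {f \<in> W. T f = complex_of_real l *s f}"

definition eigenvalues ::
  "(complex ^ 'v::finite) set \<Rightarrow> (complex ^ 'v \<Rightarrow> complex ^ 'v) \<Rightarrow> real set" where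
  "eigenvalues W T = {l. \<exists>f \<in> eigenspace W T l. f \<noteq> 0}"

definition eigenvalue_list ::
  "(complex ^ 'v::finite) set \<Rightarrow> (complex ^ 'v \<Rightarrow> complex ^ 'v) \<Rightarrow> real list" where
  "eigenvalue_list W T =
     concat (map (\<lambda>l. replicate (vec.dim (eigenspace W T l)) l)
                 (sorted_list_of_set (eigenvalues W T)))"

text \<open>Eigenvalues are numbered from 1.\<close>

definition nth_eigenvalue ::
  "(complex ^ 'v::finite) set \<Rightarrow> (complex ^ 'v \<Rightarrow> complex ^ 'v) \<Rightarrow> nat \<Rightarrow> real" where
  "nth_eigenvalue W T k = eigenvalue_list W T ! (k - 1)"

definition inner_m :: "('v::finite \<Rightarrow> real) \<Rightarrow> complex ^ 'v \<Rightarrow> complex ^ 'v \<Rightarrow> complex" where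
  "inner_m m f g = (\<Sum>x\<in>UNIV. complex_of_real (m x) * (f $ x) * cnj (g $ x))"

context weighted_digraph
begin

lemma sym_weight_commute: "sym_weight b x y = sym_weight b y x"
  by (simp add: sym_weight_def)

lemma sym_weight_eq_0: "y \<notin> nbrs E x \<Longrightarrow> sym_weight b x y = 0"
  using b_nonneg b_pos_iff
  by (auto simp: nbrs_def out_nbrs_def in_nbrs_def sym_weight_def)
     (metis add_0 antisym_conv2)

lemma special_laplacian_nth:
  "complex_of_real (m x) * special_laplacian E b m f $ x =
     (\<Sum>y\<in>UNIV. complex_of_real (sym_weight b x y) * (f $ x - f $ y))"
proof -
  have "(\<Sum>y\<in>nbrs E x. complex_of_real (sym_weight b x y) * (f $ x - f $ y)) =
        (\<Sum>y\<in>UNIV. complex_of_real (sym_weight b x y) * (f $ x - f $ y))"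
    by (rule sum.mono_neutral_left) (auto simp: sym_weight_eq_0)
  then show ?thesis
    using m_pos[of x] by (simp add: special_laplacian_def)
qed

lemma special_laplacian_selfadjoint:
  "inner_m m (special_laplacian E b m f) g = inner_m m f (special_laplacian E b m g)"
proof -
  let ?a = "\<lambda>x y. complex_of_real (sym_weight b x y)"
  have L: "inner_m m (special_laplacian E b m f) g =
      (\<Sum>x\<in>UNIV. \<Sum>y\<in>UNIV. ?a x y * (f $ x - f $ y) * cnj (g $ x))"
    by (simp add: inner_m_def special_laplacian_nth sum_distrib_right)
  have "complex_of_real (m x) * f $ x * cnj (special_laplacian E b m g $ x) =
      (\<Sum>y\<in>UNIV. ?a x y * f $ x * (cnj (g $ x) - cnj (g $ y)))" for x
  proof -
    have "complex_of_real (m x) * f $ x * cnj (special_laplacian E b m g $ x) =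
      f $ x * cnj (complex_of_real (m x) * special_laplacian E b m g $ x)"
      by simp
    then show ?thesis
      unfolding special_laplacian_nth by (simp add: sum_distrib_left mult_ac)
  qed
  then have R: "inner_m m f (special_laplacian E b m g) =
      (\<Sum>x\<in>UNIV. \<Sum>y\<in>UNIV. ?a x y * f $ x * (cnj (g $ x) - cnj (g $ y)))"
    by (simp add: inner_m_def)
  have "(\<Sum>x\<in>UNIV. \<Sum>y\<in>UNIV. ?a x y * f $ y * cnj (g $ x)) =
        (\<Sum>x\<in>UNIV. \<Sum>y\<in>UNIV. ?a x y * f $ x * cnj (g $ y))"
    by (subst sum.swap) (simp add: sym_weight_commute)
  then show ?thesis
    unfolding L R by (simp add: algebra_simps sum_subtractf)
qed

lemma dirichlet_laplacian_selfadjoint: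
  assumes "f \<in> supported_in VH" "g \<in> supported_in VH"
  shows "inner_m m (dirichlet_laplacian E b m VH f) g =
         inner_m m f (dirichlet_laplacian E b m VH g)"
proof -
  have "inner_m m (dirichlet_laplacian E b m VH f) g = inner_m m (special_laplacian E b m f) g"
    "inner_m m f (dirichlet_laplacian E b m VH g) = inner_m m f (special_laplacian E b m g)"
    using assms
    by (auto simp: inner_m_def dirichlet_laplacian_def supported_in_def intro!: sum.cong)
  then show ?thesis by (simp add: special_laplacian_selfadjoint)
qed

lemma inner_m_self_eq_0: "inner_m m f f = 0 \<Longrightarrow> f = 0"
proof -
  assume "inner_m m f f = 0"
  moreover have "inner_m m f f = complex_of_real (\<Sum>x\<in>UNIV. m x * (cmod (f $ x))\<^sup>2)"
    by (simp only: inner_m_def of_real_sum of_real_mult complex_norm_square mult.assoc)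
  ultimately have "(\<Sum>x\<in>UNIV. m x * (cmod (f $ x))\<^sup>2) = 0"
    using of_real_eq_0_iff by metis
  moreover have "\<And>x. m x * (cmod (f $ x))\<^sup>2 \<ge> 0"
    using m_pos by (simp add: less_imp_le)
  ultimately have "\<And>x. m x * (cmod (f $ x))\<^sup>2 = 0"
    by (simp add: sum_nonneg_eq_0_iff)
  then show "f = 0"
    using m_pos by (simp add: vec_eq_iff) (metis less_irrefl)
qed

lemma eigenvalue_real:
  assumes "inner_m m (T f) f = inner_m m f (T f)" and "T f = c *s f" and "f \<noteq> 0"
  shows "c \<in> \<real>"
proof -
  have "c * inner_m m f f = cnj c * inner_m m f f"
    using assms(1) unfolding assms(2)
    by (simp add: inner_m_def sum_distrib_left mult_ac)
  then have "c = cnj c" using inner_m_self_eq_0 assms(3) by auto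
  then show ?thesis by (simp add: Reals_cnj_iff)
qed

end

end

theory Submission
  imports Defs
begin

text \<open>
  This is Cauchy interlacing for the compression of the special Laplacian to the functions
  supported in \<open>VH\<close>. If \<open>d = \<lambda>\<^sub>k(S\<^sup>D)\<close> exceeded \<open>c = \<lambda>\<^sub>k\<^sub>+\<^sub>n\<^sub>-\<^sub>r(S)\<close>, the eigenvectors of
  \<open>S\<close> with eigenvalue at most \<open>c\<close> (at least \<open>k + n - r\<close> of them) and those of \<open>S\<^sup>D\<close> with
  eigenvalue at least \<open>d\<close> (at least \<open>r - k + 1\<close>) would span subspaces with a common nonzero
  vector \<open>f\<close>, and \<open>d (f,f) \<le> (S\<^sup>D f,f) = (S f,f) \<le> c (f,f)\<close>.  Orthogonal eigenbases come from
  maximising the Rayleigh quotient on the unit sphere.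
\<close>

section \<open>The weighted inner product\<close>

definition sqnorm_m :: "('v::finite \<Rightarrow> real) \<Rightarrow> complex ^ 'v \<Rightarrow> real" where
  "sqnorm_m m f = Re (inner_m m f f)"

lemma inner_m_add_left: "inner_m m (f + g) h = inner_m m f h + inner_m m g h"
  by (simp add: inner_m_def algebra_simps sum.distrib)

lemma inner_m_scale_left: "inner_m m (c *s f) h = c * inner_m m f h"
  by (simp add: inner_m_def algebra_simps sum_distrib_left)

lemma inner_m_zero_left [simp]: "inner_m m 0 h = 0"
  by (simp add: inner_m_def)

lemma inner_m_cnj: "cnj (inner_m m f g) = inner_m m g f"
  by (simp add: inner_m_def mult_ac)

lemma inner_m_scale_right: "inner_m m h (c *s f) = cnj c * inner_m m h f"
  by (simp add: inner_m_def algebra_simps sum_distrib_left)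

lemma inner_m_diff_left: "inner_m m (f - g) h = inner_m m f h - inner_m m g h"
  by (simp add: inner_m_def algebra_simps sum_subtractf)

lemma inner_m_diff_right: "inner_m m h (f - g) = inner_m m h f - inner_m m h g"
  by (simp add: inner_m_def algebra_simps sum_subtractf)

lemma inner_m_sum_left: "inner_m m (\<Sum>i\<in>I. F i) h = (\<Sum>i\<in>I. inner_m m (F i) h)"
  by (induction I rule: infinite_finite_induct) (auto simp: inner_m_add_left)

lemma inner_m_orthogonal_sum_left:
  assumes "finite B" "\<And>v w. v \<in> B \<Longrightarrow> w \<in> B \<Longrightarrow> v \<noteq> w \<Longrightarrow> inner_m m v w = 0" "w \<in> B"
  shows "inner_m m (\<Sum>v\<in>B. c v *s v) w = c w * inner_m m w w"
proof -
  have "inner_m m (\<Sum>v\<in>B. c v *s v) w = (\<Sum>v\<in>B. if v = w then c w * inner_m m w w else 0)"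
    unfolding inner_m_sum_left inner_m_scale_left
    using assms by (intro sum.cong) auto
  then show ?thesis using assms by simp
qed

lemma inner_m_self_sum: "inner_m m f f = complex_of_real (\<Sum>x\<in>UNIV. m x * (cmod (f $ x))\<^sup>2)"
  by (simp only: inner_m_def of_real_sum of_real_mult complex_norm_square mult.assoc)

lemma sqnorm_m_eq_sum: "sqnorm_m m f = (\<Sum>x\<in>UNIV. m x * (cmod (f $ x))\<^sup>2)"
  by (simp add: sqnorm_m_def inner_m_self_sum)

lemma inner_m_self: "inner_m m f f = complex_of_real (sqnorm_m m f)"
  by (simp only: sqnorm_m_eq_sum inner_m_self_sum)

section \<open>Counting in sorted lists and intersecting spans\<close>

lemma count_concat_replicate:
  "distinct ls \<Longrightarrow>
     count (mset (concat (map (\<lambda>l. replicate (d l) l) ls))) x =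
       (if x \<in> set ls then d x else 0)"
  by (induction ls) auto

lemma sorted_concat_replicate:
  "sorted ls \<Longrightarrow> sorted (concat (map (\<lambda>l. replicate (d l) l) ls))"
  by (induction ls) (auto simp: sorted_append)

text \<open>By sortedness the positions \<open>0, ..., i\<close> all qualify; ties with
  \<open>xs ! i\<close> further on can only add to them, hence an inequality.\<close>

lemma sorted_nth_le_filter:
  assumes "sorted xs" "i < length xs"
  shows "length (filter (\<lambda>x. x \<le> xs ! i) xs) \<ge> Suc i"
proof -
  have "{..i} \<subseteq> {j. j < length xs \<and> xs ! j \<le> xs ! i}"
    using assms by (auto simp: sorted_nth_mono)
  from card_mono[OF _ this] show ?thesis by (simp add: length_filter_conv_card)
qed

lemma sorted_nth_ge_filter:
  assumes "sorted xs" "i < length xs"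
  shows "length (filter (\<lambda>x. xs ! i \<le> x) xs) \<ge> length xs - i"
proof -
  have "{i..<length xs} \<subseteq> {j. j < length xs \<and> xs ! i \<le> xs ! j}"
    using assms by (auto simp: sorted_nth_mono)
  from card_mono[OF _ this] show ?thesis by (simp add: length_filter_conv_card)
qed

text \<open>The sum of the two spans has dimension at most \<open>CARD('v)\<close>, so the dimension
  formula leaves an intersection of positive dimension.\<close>

lemma spans_meet_nontrivially:
  fixes A B :: "(complex ^ 'v::finite) set"
  assumes "vec.independent A" "vec.independent B" "card A + card B > CARD('v)"
  obtains f where "f \<in> vec.span A" "f \<in> vec.span B" "f \<noteq> 0"
proof -
  let ?D = "{x + y |x y. x \<in> vec.span A \<and> y \<in> vec.span B}"
  have "vec.dim ?D + vec.dim (vec.span A \<inter> vec.span B) = card A + card B"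
    using assms vec.dim_sums_Int[of "vec.span A" "vec.span B"]
    by (simp add: vec.dim_span_eq_card_independent vec.subspace_span del: vec.dim_span)
  moreover have "vec.dim ?D \<le> CARD('v)"
    using vec.dim_subset_UNIV[of ?D] by (simp add: vec.dimension_def card_cart_basis)
  ultimately have "vec.dim (vec.span A \<inter> vec.span B) > 0" using assms by linarith
  then have "\<not> vec.span A \<inter> vec.span B \<subseteq> {0}"
    by (metis vec.dim_eq_0 less_irrefl)
  then show ?thesis using that by auto
qed

section \<open>Spectral theorem for the weighted inner product\<close>

locale positive_weight =
  fixes m :: "'v::finite \<Rightarrow> real"
  assumes m_pos: "m x > 0"
begin

lemma sqnorm_m_pos: "f \<noteq> 0 \<Longrightarrow> sqnorm_m m f > 0"
proof -
  assume "f \<noteq> 0"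
  then obtain x where "f $ x \<noteq> 0" by (auto simp: vec_eq_iff)
  then show ?thesis unfolding sqnorm_m_eq_sum
    using m_pos by (intro sum_pos2[of _ x]) (auto simp: less_imp_le)
qed

text \<open>The Rayleigh quotient attains its maximum \<open>l\<close> on the compact unit sphere of
  \<open>W\<close>. At a maximiser \<open>v\<close> the first variation vanishes; the residual
  \<open>l v - T v\<close> lies in \<open>W\<close> by invariance, so it may be used as the test
  direction and must be zero.\<close>

lemma selfadjoint_has_eigenvector:
  assumes lin: "Vector_Spaces.linear (*s) (*s) T"
    and sub: "vec.subspace W" and inv: "\<And>f. f \<in> W \<Longrightarrow> T f \<in> W"
    and sa: "\<And>f g. f \<in> W \<Longrightarrow> g \<in> W \<Longrightarrow> inner_m m (T f) g = inner_m m f (T g)"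
    and nz: "g \<in> W" "g \<noteq> 0"
  obtains l v where "v \<in> W" "v \<noteq> 0" "T v = complex_of_real l *s v"
proof -
  interpret T: Vector_Spaces.linear "(*s)" "(*s)" T by fact
  \<comment> \<open>Compactness and continuity belong to the real normed structure,
    \<open>vec.subspace\<close> and \<open>T\<close> to the complex one; this identity passes
    between them.\<close>
  have scaleR: "c *\<^sub>R f = complex_of_real c *s f" for c and f :: "complex ^ 'v"
    by (simp add: vec_eq_iff complex_eq_iff)
  have "linear T"
    by (rule linearI) (auto simp: T.add T.scale scaleR)
  then have contT: "continuous_on S T" for S
    by (simp add: linear_continuous_on linear_conv_bounded_linear)
  have "subspace W"
    using sub by (auto simp: subspace_def vec.subspace_def scaleR)
  then have cpt: "compact (W \<inter> sphere 0 1)"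
    by (simp add: closed_Int_compact closed_subspace)
  \<comment> \<open>The sphere is that of the standard norm, not of \<open>sqnorm_m\<close>, hence
    the division; the quotient is invariant under scaling.\<close>
  define R where "R f = Re (inner_m m (T f) f) / sqnorm_m m f" for f
  have "continuous_on (W \<inter> sphere 0 1) R"
    unfolding R_def sqnorm_m_def
  proof (intro continuous_intros ballI)
    show "continuous_on (W \<inter> sphere 0 1) (\<lambda>f. inner_m m (T f) f)"
      "continuous_on (W \<inter> sphere 0 1) (\<lambda>f. inner_m m f f)"
      unfolding inner_m_def by (auto intro!: continuous_intros contT)
    show "Re (inner_m m f f) \<noteq> 0" if "f \<in> W \<inter> sphere 0 1" for f
      using that sqnorm_m_pos[of f] by (cases "f = 0") (auto simp: sqnorm_m_def)
  qed
  moreover have normalize: "g /\<^sub>R norm g \<in> W \<inter> sphere 0 1" if "g \<in> W" "g \<noteq> 0" for g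
    using \<open>subspace W\<close> that by (auto simp: subspace_def)
  ultimately obtain v where v: "v \<in> W \<inter> sphere 0 1"
    and max: "\<And>f. f \<in> W \<inter> sphere 0 1 \<Longrightarrow> R f \<le> R v"
    using continuous_attains_sup[OF cpt] nz by (metis empty_iff)
  define l where "l = R v"
  \<comment> \<open>Clearing the denominator turns maximality of \<open>R v\<close> into
    nonnegativity of a quadratic form that vanishes at \<open>v\<close>.\<close>
  define q where "q f = l * sqnorm_m m f - Re (inner_m m (T f) f)" for f
  have q_nonneg: "q f \<ge> 0" if "f \<in> W" for f
  proof (cases "f = 0")
    case True
    then show ?thesis by (simp add: q_def sqnorm_m_def T.zero)
  next
    case False
    define c where "c = complex_of_real (inverse (norm f))"
    have "R (c *s f) = R f"
      using False by (simp add: R_def sqnorm_m_def T.scale inner_m_scale_left inner_m_scale_right c_def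
          field_simps)
    then have "R f \<le> l"
      using max[OF normalize[OF that False]] by (simp add: scaleR c_def l_def)
    then show ?thesis
      using sqnorm_m_pos[OF False] by (simp add: q_def R_def field_simps)
  qed
  have "v \<noteq> 0" using v by auto
  then have qv: "q v = 0"
    using sqnorm_m_pos[of v] by (simp add: q_def l_def R_def)
  define h where "h = complex_of_real l *s v - T v"
  have h: "h \<in> W" using v inv sub by (auto simp: h_def intro!: vec.subspace_diff vec.subspace_scale)
  \<comment> \<open>Self-adjointness moves \<open>T\<close> from \<open>h\<close> onto
    \<open>v\<close>, so the linear terms combine to the real part of \<open>(l v - T v, h)\<close>,
    which is the square norm of \<open>h\<close>.\<close>
  have perturb: "q (v - complex_of_real t *s h) = t\<^sup>2 * q h - 2 * t * sqnorm_m m h" for t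
  proof -
    have 1: "inner_m m (T h) v = inner_m m h (T v)" using sa h v by auto
    have 2: "Re (inner_m m h v) = Re (inner_m m v h)" "Re (inner_m m h (T v)) = Re (inner_m m (T v) h)"
      by (metis inner_m_cnj complex_cnj(1) cnj.simps(1))+
    have 3: "sqnorm_m m h = l * Re (inner_m m v h) - Re (inner_m m (T v) h)"
      by (simp add: sqnorm_m_def h_def inner_m_diff_left inner_m_scale_left)
    have "q (v - complex_of_real t *s h) =
       q v + t\<^sup>2 * q h - 2 * t * (l * Re (inner_m m v h) - Re (inner_m m (T v) h))"
      by (simp add: q_def sqnorm_m_def T.diff T.scale inner_m_diff_left inner_m_diff_right
          inner_m_scale_left inner_m_scale_right 1 2 algebra_simps power2_eq_square)
    then show ?thesis by (simp add: qv 3)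
  qed
  \<comment> \<open>\<open>q \<ge> 0\<close> on \<open>W\<close>, but moving from its zero \<open>v\<close> towards \<open>- h\<close> changes it to first order by \<open>- 2 t |h|\<^sup>2\<close>.\<close>
  have "h = 0"
  proof (rule ccontr)
    assume "h \<noteq> 0"
    then have p: "sqnorm_m m h > 0" by (rule sqnorm_m_pos)
    \<comment> \<open>Small enough that \<open>t * q h\<close> stays below
      \<open>sqnorm_m m h\<close>; the \<open>+ 1\<close> keeps the denominator positive when
      \<open>q h = 0\<close>.\<close>
    define t where "t = sqnorm_m m h / (q h + 1)"
    have qh: "q h \<ge> 0" using q_nonneg h by simp
    have "t > 0" using p qh by (simp add: t_def)
    have "t * q h < sqnorm_m m h * 1" using p qh by (simp add: t_def field_simps)
    have "0 \<le> t * (t * q h - 2 * sqnorm_m m h)"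
      using q_nonneg[of "v - complex_of_real t *s h"] v h sub perturb[of t]
      by (auto simp: power2_eq_square algebra_simps intro!: vec.subspace_diff vec.subspace_scale)
    then have "t * q h \<ge> 2 * sqnorm_m m h" using \<open>t > 0\<close> by (simp add: zero_le_mult_iff)
    then show False using \<open>t * q h < _\<close> p by simp
  qed
  then show ?thesis using that[of v l] v \<open>v \<noteq> 0\<close> by (auto simp: h_def)
qed

end

text \<open>The vectors are not normalised; their square norms are absorbed into the weights of
  \<open>quadratic_form_eigenbasis\<close>.\<close>

definition orthogonal_eigenbasis ::
  "('v::finite \<Rightarrow> real) \<Rightarrow> (complex ^ 'v) set \<Rightarrow> (complex ^ 'v \<Rightarrow> complex ^ 'v) \<Rightarrow>
     (complex ^ 'v \<Rightarrow> real) \<Rightarrow> (complex ^ 'v) set \<Rightarrow> bool" where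
  "orthogonal_eigenbasis m W T \<mu> B \<longleftrightarrow>
     finite B \<and> 0 \<notin> B \<and> (\<forall>v\<in>B. \<forall>w\<in>B. v \<noteq> w \<longrightarrow> inner_m m v w = 0) \<and>
     vec.span B = W \<and> (\<forall>v\<in>B. T v = complex_of_real (\<mu> v) *s v)"

lemma inner_m_span_eq_0:
  assumes "f \<in> vec.span B" "\<And>v. v \<in> B \<Longrightarrow> inner_m m v g = 0"
  shows "inner_m m f g = 0"
  using assms(1)
  by (induction rule: vec.span_induct_alt)
     (simp_all add: inner_m_add_left inner_m_scale_left assms(2))

context positive_weight
begin

text \<open>Induction on the dimension: after splitting off an eigenvector \<open>v\<close>, its
  orthogonal complement in \<open>W\<close> is strictly smaller and, by self-adjointness, again
  invariant under \<open>T\<close>.\<close>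

theorem selfadjoint_eigenbasis:
  assumes lin: "Vector_Spaces.linear (*s) (*s) T"
    and "vec.subspace W" and "\<And>f. f \<in> W \<Longrightarrow> T f \<in> W"
    and "\<And>f g. f \<in> W \<Longrightarrow> g \<in> W \<Longrightarrow> inner_m m (T f) g = inner_m m f (T g)"
  shows "\<exists>\<mu> B. orthogonal_eigenbasis m W T \<mu> B"
  using assms(2-)
proof (induction "vec.dim W" arbitrary: W rule: less_induct)
  case less
  note sub = less.prems(1) and inv = less.prems(2) and sa = less.prems(3)
  show ?case
  proof (cases "W \<subseteq> {0}")
    case True
    then have "W = {0}" using sub vec.subspace_0 by blast
    then have "orthogonal_eigenbasis m W T (\<lambda>_. 0) {}"
      by (simp add: orthogonal_eigenbasis_def)
    then show ?thesis by blast
  next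
    case False
    then obtain g where "g \<in> W" "g \<noteq> 0" by auto
    then obtain l v where v: "v \<in> W" "v \<noteq> 0" "T v = complex_of_real l *s v"
      using selfadjoint_has_eigenvector[OF lin sub inv sa] by metis
    define W' where "W' = {w \<in> W. inner_m m w v = 0}"
    have vv: "inner_m m v v \<noteq> 0"
      using sqnorm_m_pos[OF v(2)] by (simp add: inner_m_self)
    have sub': "vec.subspace W'"
      using sub by (auto simp: W'_def vec.subspace_def inner_m_add_left inner_m_scale_left)
    have "W' \<subset> W" using v vv by (auto simp: W'_def)
    then have "vec.span W' \<subset> vec.span W"
      using sub sub' by (metis vec.span_eq_iff)
    then have "vec.dim W' < vec.dim W" by (rule vec.dim_psubset)
    moreover have "T f \<in> W'" if "f \<in> W'" for f
      using that inv sa[of f v] v by (auto simp: W'_def inner_m_scale_right)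
    moreover have "inner_m m (T f) g = inner_m m f (T g)" if "f \<in> W'" "g \<in> W'" for f g
      using that sa by (auto simp: W'_def)
    ultimately obtain \<mu> B where B: "orthogonal_eigenbasis m W' T \<mu> B"
      using less.hyps[OF _ sub'] by blast
    have BW': "B \<subseteq> W'" using B vec.span_superset by (auto simp: orthogonal_eigenbasis_def)
    then have ortho: "inner_m m w v = 0" "inner_m m v w = 0" if "w \<in> B" for w
      using that inner_m_cnj[of m w v] by (auto simp: W'_def)
    have "v \<notin> B" using ortho vv by blast
    have "vec.span (insert v B) = W"
    proof
      show "vec.span (insert v B) \<subseteq> W"
        using BW' v sub by (intro vec.span_minimal) (auto simp: W'_def)
      show "W \<subseteq> vec.span (insert v B)"
      proof
        fix w assume w: "w \<in> W"
        \<comment> \<open>The coefficient of the orthogonal projection of \<open>w\<close> onto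
          \<open>v\<close>, so that the remainder falls into \<open>W'\<close>.\<close>
        define c where "c = inner_m m w v / inner_m m v v"
        have "w - c *s v \<in> W'"
          using w v sub vv
          by (auto simp: W'_def c_def inner_m_diff_left inner_m_scale_left
              intro!: vec.subspace_diff vec.subspace_scale)
        then show "w \<in> vec.span (insert v B)"
          using B unfolding vec.span_insert orthogonal_eigenbasis_def by blast
      qed
    qed
    \<comment> \<open>As \<open>v\<close> is not in \<open>B\<close>, the update leaves the
      eigenvalues attached to \<open>B\<close> unchanged.\<close>
    then have "orthogonal_eigenbasis m W T (\<mu>(v := l)) (insert v B)"
      using B v \<open>v \<notin> B\<close> ortho by (auto simp: orthogonal_eigenbasis_def)
    then show ?thesis by blast
  qed
qed

text \<open>A vector in the span of the others would be orthogonal to itself.\<close>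

lemma orthogonal_independent:
  assumes "0 \<notin> B" "\<And>v w. v \<in> B \<Longrightarrow> w \<in> B \<Longrightarrow> v \<noteq> w \<Longrightarrow> inner_m m v w = 0"
  shows "vec.independent B"
proof
  assume "vec.dependent B"
  then obtain w where w: "w \<in> B" "w \<in> vec.span (B - {w})"
    by (auto simp: vec.dependent_def)
  then have "inner_m m w w = 0"
    using assms by (intro inner_m_span_eq_0[of w "B - {w}"]) auto
  then show False using sqnorm_m_pos[of w] w assms by (auto simp: inner_m_self)
qed

section \<open>Spectrum and quadratic form read off an eigenbasis\<close>

context
  fixes W T \<mu> B
  assumes lin: "Vector_Spaces.linear (*s) (*s) T"
    and basis: "orthogonal_eigenbasis m W T \<mu> B"
begin

lemma eigenbasis_independent: "B' \<subseteq> B \<Longrightarrow> vec.independent B'"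
  using basis by (intro orthogonal_independent) (auto simp: orthogonal_eigenbasis_def)

lemma eigenbasis_apply:
  assumes "B' \<subseteq> B"
  shows "T (\<Sum>v\<in>B'. c v *s v) = (\<Sum>v\<in>B'. (c v * complex_of_real (\<mu> v)) *s v)"
proof -
  interpret T: Vector_Spaces.linear "(*s)" "(*s)" T by (fact lin)
  show ?thesis
    unfolding T.sum T.scale
  proof (rule sum.cong[OF refl])
    fix v assume "v \<in> B'"
    then have "T v = complex_of_real (\<mu> v) *s v"
      using assms basis by (auto simp: orthogonal_eigenbasis_def)
    then show "c v *s T v = (c v * complex_of_real (\<mu> v)) *s v"
      by (simp only: vector_smult_assoc)
  qed
qed

text \<open>Pairing \<open>T f = l f\<close> with a basis vector \<open>w\<close> and cancelling
  \<open>(w, w)\<close> gives \<open>c w * (\<mu> w - l) = 0\<close>, so only basis vectors with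
  eigenvalue \<open>l\<close> survive in the expansion of \<open>f\<close>.\<close>

lemma eigenspace_eq_span: "eigenspace W T l = vec.span {v \<in> B. \<mu> v = l}"
proof
  have fin: "finite B" and ortho: "\<And>v w. v \<in> B \<Longrightarrow> w \<in> B \<Longrightarrow> v \<noteq> w \<Longrightarrow> inner_m m v w = 0"
    and span: "vec.span B = W" and nz: "0 \<notin> B"
    using basis by (auto simp: orthogonal_eigenbasis_def)
  show "eigenspace W T l \<subseteq> vec.span {v \<in> B. \<mu> v = l}"
  proof
    fix f assume f: "f \<in> eigenspace W T l"
    then have "f \<in> vec.span B" using span by (simp add: eigenspace_def)
    then obtain c where c: "f = (\<Sum>v\<in>B. c v *s v)"
      using vec.span_finite[OF fin] by auto
    have "c w = 0" if w: "w \<in> B" "\<mu> w \<noteq> l" for w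
    proof -
      have "inner_m m (T f) w = complex_of_real l * inner_m m f w"
        using f by (simp add: eigenspace_def inner_m_scale_left)
      then have "c w * complex_of_real (\<mu> w) * inner_m m w w =
          complex_of_real l * (c w * inner_m m w w)"
        using w(1) fin ortho
        by (simp add: c eigenbasis_apply inner_m_orthogonal_sum_left)
      moreover have "inner_m m w w \<noteq> 0"
        using sqnorm_m_pos[of w] w nz by (metis inner_m_self less_irrefl of_real_eq_0_iff)
      ultimately show ?thesis using w by auto
    qed
    then have "f = (\<Sum>v\<in>{v \<in> B. \<mu> v = l}. c v *s v)"
      unfolding c by (intro sum.mono_neutral_right) (auto simp: fin)
    then show "f \<in> vec.span {v \<in> B. \<mu> v = l}"
      by (simp only:) (rule vec.span_sum, rule vec.span_scale, rule vec.span_base)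
  qed
  show "vec.span {v \<in> B. \<mu> v = l} \<subseteq> eigenspace W T l"
  proof
    fix f assume f: "f \<in> vec.span {v \<in> B. \<mu> v = l}"
    then obtain c where c: "f = (\<Sum>v\<in>{v \<in> B. \<mu> v = l}. c v *s v)"
      using vec.span_finite[of "{v \<in> B. \<mu> v = l}"] fin by auto
    have "T f = complex_of_real l *s f"
      by (simp add: c eigenbasis_apply vec.scale_sum_right mult.commute)
    moreover have "f \<in> W" using f vec.span_mono[of "{v \<in> B. \<mu> v = l}" B] span by auto
    ultimately show "f \<in> eigenspace W T l" by (simp add: eigenspace_def)
  qed
qed

text \<open>This also shows that the spectrum is finite, so \<open>sorted_list_of_set\<close>
  enumerates it instead of defaulting to the empty list.\<close>

lemma eigenvalues_eq_image: "eigenvalues W T = \<mu> ` B"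
proof
  show "eigenvalues W T \<subseteq> \<mu> ` B"
  proof
    fix l assume "l \<in> eigenvalues W T"
    then obtain f where "f \<in> vec.span {v \<in> B. \<mu> v = l}" "f \<noteq> 0"
      by (auto simp: eigenvalues_def eigenspace_eq_span)
    then show "l \<in> \<mu> ` B" by (cases "{v \<in> B. \<mu> v = l} = {}") auto
  qed
  show "\<mu> ` B \<subseteq> eigenvalues W T"
  proof
    fix l assume "l \<in> \<mu> ` B"
    then obtain v where "v \<in> vec.span {v \<in> B. \<mu> v = l}" "v \<in> B"
      by (auto intro: vec.span_base)
    moreover from this have "v \<noteq> 0" using basis by (auto simp: orthogonal_eigenbasis_def)
    ultimately show "l \<in> eigenvalues W T"
      by (auto simp: eigenvalues_def eigenspace_eq_span)
  qed
qed

text \<open>Each eigenspace is spanned by the independent basis vectors carrying its eigenvalue, so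
  their number is the multiplicity in the list.\<close>

lemma mset_eigenvalue_list: "mset (eigenvalue_list W T) = image_mset \<mu> (mset_set B)"
proof (rule multiset_eqI)
  fix l
  have fin: "finite B" using basis by (simp add: orthogonal_eigenbasis_def)
  have "vec.dim (eigenspace W T l) = card {v \<in> B. \<mu> v = l}"
    using eigenbasis_independent[of "{v \<in> B. \<mu> v = l}"]
    by (simp add: eigenspace_eq_span vec.dim_span_eq_card_independent del: vec.dim_span)
  then have "count (mset (eigenvalue_list W T)) l = card {v \<in> B. \<mu> v = l}"
    using fin unfolding eigenvalue_list_def
    by (subst count_concat_replicate)
       (auto simp: eigenvalues_eq_image card_eq_0_iff)
  also have "{v \<in> B. \<mu> v = l} = \<mu> -` {l} \<inter> B" by auto
  finally show "count (mset (eigenvalue_list W T)) l = count (image_mset \<mu> (mset_set B)) l"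
    using fin by (simp add: count_image_mset Int_commute)
qed

text \<open>Converts counts of list entries into numbers of independent eigenvectors, to which a
  dimension count applies.\<close>

lemma length_filter_eigenvalue_list:
  "length (filter P (eigenvalue_list W T)) = card {v \<in> B. P (\<mu> v)}"
proof -
  have fin: "finite B" using basis by (simp add: orthogonal_eigenbasis_def)
  have "length (filter P (eigenvalue_list W T)) = size (filter_mset P (mset (eigenvalue_list W T)))"
    by (simp only: size_mset flip: mset_filter)
  also have "\<dots> = card {v \<in> B. P (\<mu> v)}"
    using fin by (simp add: mset_eigenvalue_list filter_mset_image_mset)
  finally show ?thesis .
qed

text \<open>Guarantees that \<open>nth_eigenvalue W T k\<close> reads inside the list for
  \<open>1 \<le> k \<le> vec.dim W\<close>.\<close>

lemma length_eigenvalue_list: "length (eigenvalue_list W T) = vec.dim W"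
  using length_filter_eigenvalue_list[of "\<lambda>_. True"] basis
    vec.dim_span_eq_card_independent[OF eigenbasis_independent[OF order_refl]]
  by (simp add: orthogonal_eigenbasis_def)

text \<open>Parseval: \<open>d v\<close> is the squared modulus of the coefficient of
  \<open>v\<close> times the square norm of \<open>v\<close>, and \<open>T\<close> multiplies that
  coefficient by \<open>\<mu> v\<close>.\<close>

lemma quadratic_form_eigenbasis:
  assumes "B' \<subseteq> B" "f \<in> vec.span B'"
  obtains d where "\<And>v. d v \<ge> 0" "sqnorm_m m f = (\<Sum>v\<in>B'. d v)"
    "Re (inner_m m (T f) f) = (\<Sum>v\<in>B'. \<mu> v * d v)"
proof -
  have fin: "finite B'" and ortho: "\<And>v w. v \<in> B' \<Longrightarrow> w \<in> B' \<Longrightarrow> v \<noteq> w \<Longrightarrow> inner_m m v w = 0"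
    using basis assms(1) by (auto simp: orthogonal_eigenbasis_def intro: finite_subset)
  obtain c where c: "f = (\<Sum>v\<in>B'. c v *s v)"
    using assms(2) vec.span_finite[OF fin] by auto
  define d where "d v = (cmod (c v))\<^sup>2 * sqnorm_m m v" for v
  have coord: "c v * inner_m m v f = complex_of_real (d v)" if "v \<in> B'" for v
  proof -
    have "inner_m m v f = cnj (c v * inner_m m v v)"
      using inner_m_orthogonal_sum_left[OF fin ortho that, of c] inner_m_cnj[of m f v] c by simp
    then show ?thesis
      by (simp add: d_def inner_m_self complex_norm_square[unfolded of_real_power] flip: mult.assoc)
  qed
  \<comment> \<open>One identity for arbitrary factors \<open>e\<close>: the constant 1 yields the
    square norm, \<open>\<mu>\<close> the form of \<open>T\<close>.\<close>
  have form: "inner_m m (\<Sum>v\<in>B'. (c v * complex_of_real (e v)) *s v) f =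
      complex_of_real (\<Sum>v\<in>B'. e v * d v)" for e
    by (simp add: inner_m_sum_left inner_m_scale_left mult.assoc mult.left_commute[of "c _"] coord)
  show ?thesis
  proof (rule that[of d])
    show "d v \<ge> 0" for v
      using sqnorm_m_pos[of v] by (cases "v = 0") (auto simp: d_def sqnorm_m_def less_imp_le)
    show "sqnorm_m m f = (\<Sum>v\<in>B'. d v)"
      using form[of "\<lambda>_. 1"] by (simp add: sqnorm_m_def flip: c)
    show "Re (inner_m m (T f) f) = (\<Sum>v\<in>B'. \<mu> v * d v)"
      using form[of \<mu>] eigenbasis_apply[OF assms(1), of c] by (simp flip: c)
  qed
qed

text \<open>Here the form is a sum of eigenvalues at most \<open>c\<close> with nonnegative weights
  of total \<open>sqnorm_m m f\<close>.\<close>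

lemma quadratic_form_le:
  assumes "f \<in> vec.span {v \<in> B. \<mu> v \<le> c}"
  shows "Re (inner_m m (T f) f) \<le> c * sqnorm_m m f"
proof (rule quadratic_form_eigenbasis[OF _ assms])
  fix d assume "\<And>v. d v \<ge> 0" "sqnorm_m m f = (\<Sum>v\<in>{v \<in> B. \<mu> v \<le> c}. d v)"
    "Re (inner_m m (T f) f) = (\<Sum>v\<in>{v \<in> B. \<mu> v \<le> c}. \<mu> v * d v)"
  then show ?thesis by (auto simp: sum_distrib_left intro!: sum_mono mult_right_mono)
qed auto

lemma quadratic_form_ge:
  assumes "f \<in> vec.span {v \<in> B. c \<le> \<mu> v}"
  shows "c * sqnorm_m m f \<le> Re (inner_m m (T f) f)"
proof (rule quadratic_form_eigenbasis[OF _ assms])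
  fix d assume "\<And>v. d v \<ge> 0" "sqnorm_m m f = (\<Sum>v\<in>{v \<in> B. c \<le> \<mu> v}. d v)"
    "Re (inner_m m (T f) f) = (\<Sum>v\<in>{v \<in> B. c \<le> \<mu> v}. \<mu> v * d v)"
  then show ?thesis by (auto simp: sum_distrib_left intro!: sum_mono mult_right_mono)
qed auto

end

section \<open>Cauchy interlacing\<close>

text \<open>Together with invariance, \<open>compression\<close> says that on \<open>W\<close> the
  operator \<open>T\<close> is \<open>S\<close> followed by orthogonal projection onto
  \<open>W\<close>; the two quadratic forms agree there, which chains the upper and the lower
  estimate.\<close>

theorem cauchy_interlacing:
  assumes linS: "Vector_Spaces.linear (*s) (*s) S" and linT: "Vector_Spaces.linear (*s) (*s) T"
    and sub: "vec.subspace W" and inv: "\<And>f. f \<in> W \<Longrightarrow> T f \<in> W"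
    and saS: "\<And>f g. inner_m m (S f) g = inner_m m f (S g)"
    and compression: "\<And>f g. f \<in> W \<Longrightarrow> g \<in> W \<Longrightarrow> inner_m m (T f) g = inner_m m (S f) g"
    and k: "1 \<le> k" "k \<le> vec.dim W"
  shows "nth_eigenvalue W T k \<le> nth_eigenvalue UNIV S (k + CARD('v) - vec.dim W)"
proof (rule ccontr)
  let ?n = "CARD('v)" and ?r = "vec.dim W"
  let ?d = "nth_eigenvalue W T k" and ?c = "nth_eigenvalue UNIV S (k + ?n - ?r)"
  assume less: "\<not> ?d \<le> ?c"
  obtain \<mu> A where A: "orthogonal_eigenbasis m UNIV S \<mu> A"
    using selfadjoint_eigenbasis[OF linS vec.subspace_UNIV] saS by auto
  \<comment> \<open>\<open>compression\<close> is applied in each argument, in the second one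
    through conjugate symmetry, so \<open>T\<close> inherits self-adjointness from
    \<open>S\<close>.\<close>
  have "inner_m m (T f) g = inner_m m f (T g)" if "f \<in> W" "g \<in> W" for f g
    using that compression saS by (metis inner_m_cnj)
  then obtain \<nu> B where B: "orthogonal_eigenbasis m W T \<nu> B"
    using selfadjoint_eigenbasis[OF linT sub inv] by blast
  have n: "vec.dim (UNIV :: (complex ^ 'v) set) = ?n"
    by (simp add: vec.dim_UNIV vec.dimension_def card_cart_basis)
  have "?r \<le> ?n" using vec.dim_subset[of W UNIV] n by simp
  have sorted: "sorted (eigenvalue_list U R)" for U and R :: "complex ^ 'v \<Rightarrow> _"
    unfolding eigenvalue_list_def by (rule sorted_concat_replicate) simp
  \<comment> \<open>Eigenvalue number \<open>k + ?n - ?r\<close> sits at list position one less;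
    \<open>Suc\<close> restores the count.\<close>
  have "card {v \<in> A. \<mu> v \<le> ?c} \<ge> Suc (k + ?n - ?r - 1)"
    using sorted_nth_le_filter[OF sorted, of "k + ?n - ?r - 1" UNIV S] k \<open>?r \<le> ?n\<close>
    unfolding length_eigenvalue_list[OF linS A] length_filter_eigenvalue_list[OF linS A] n
    by (simp add: nth_eigenvalue_def)
  moreover have "card {v \<in> B. ?d \<le> \<nu> v} \<ge> ?r - (k - 1)"
    using sorted_nth_ge_filter[OF sorted, of "k - 1" W T] k
    unfolding length_eigenvalue_list[OF linT B] length_filter_eigenvalue_list[OF linT B]
    by (simp add: nth_eigenvalue_def)
  \<comment> \<open>The counts are at least \<open>k + ?n - ?r\<close> and
    \<open>?r - k + 1\<close>, together \<open>?n + 1\<close>.\<close>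
  ultimately have "card {v \<in> A. \<mu> v \<le> ?c} + card {v \<in> B. ?d \<le> \<nu> v} > ?n"
    using k \<open>?r \<le> ?n\<close> by linarith
  then obtain f where f: "f \<in> vec.span {v \<in> A. \<mu> v \<le> ?c}" "f \<in> vec.span {v \<in> B. ?d \<le> \<nu> v}"
      "f \<noteq> 0"
    using spans_meet_nontrivially[OF eigenbasis_independent[OF linS A]
        eigenbasis_independent[OF linT B], of "{v \<in> A. \<mu> v \<le> ?c}" "{v \<in> B. ?d \<le> \<nu> v}"]
    by auto
  have "f \<in> W"
    using f(2) vec.span_mono[of "{v \<in> B. ?d \<le> \<nu> v}" B] B by (auto simp: orthogonal_eigenbasis_def)
  have "?d * sqnorm_m m f \<le> Re (inner_m m (T f) f)"
    by (rule quadratic_form_ge[OF linT B f(2)])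
  also have "\<dots> = Re (inner_m m (S f) f)" using compression \<open>f \<in> W\<close> by simp
  also have "\<dots> \<le> ?c * sqnorm_m m f"
    by (rule quadratic_form_le[OF linS A f(1)])
  finally show False using less sqnorm_m_pos[OF f(3)] by simp
qed

end

section \<open>The special and the Dirichlet Laplacian\<close>

lemma linear_special_laplacian: "Vector_Spaces.linear (*s) (*s) (special_laplacian E b m)"
proof -
  let ?a = "\<lambda>x y. complex_of_real (sym_weight b x y)"
  have "special_laplacian E b m (f + g) = special_laplacian E b m f + special_laplacian E b m g"
    for f g
  proof -
    have "(\<Sum>y\<in>N. ?a x y * ((f + g) $ x - (f + g) $ y)) =
        (\<Sum>y\<in>N. ?a x y * (f $ x - f $ y)) + (\<Sum>y\<in>N. ?a x y * (g $ x - g $ y))" for x N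
      by (simp add: algebra_simps flip: sum.distrib)
    then show ?thesis by (simp add: special_laplacian_def vec_eq_iff add_divide_distrib)
  qed
  moreover have "special_laplacian E b m (c *s f) = c *s special_laplacian E b m f" for c f
  proof -
    have "(\<Sum>y\<in>N. ?a x y * ((c *s f) $ x - (c *s f) $ y)) =
        c * (\<Sum>y\<in>N. ?a x y * (f $ x - f $ y))" for x N
      by (simp add: algebra_simps sum_distrib_left)
    then show ?thesis by (simp add: special_laplacian_def vec_eq_iff)
  qed
  ultimately show ?thesis by unfold_locales auto
qed

lemma linear_dirichlet_laplacian: "Vector_Spaces.linear (*s) (*s) (dirichlet_laplacian E b m VH)"
proof -
  interpret Vector_Spaces.linear "(*s)" "(*s)" "special_laplacian E b m"
    by (rule linear_special_laplacian)
  show ?thesis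
    by unfold_locales (auto simp: dirichlet_laplacian_def vec_eq_iff add scale)
qed

theorem proposition4p1:
  fixes E :: "('v::finite \<times> 'v) set"
    and b :: "'v \<Rightarrow> 'v \<Rightarrow> real"
    and m :: "'v \<Rightarrow> real"
    and VH :: "'v set"
    and n r k :: nat
  assumes "standing_weighted_digraph E b m"
    and "CARD('v) = n"
    and "connected_digraph VH (induced_edges E VH)"
    and "card VH = r"
    and "1 \<le> k" and "k \<le> r"
  shows "nth_eigenvalue (supported_in VH) (dirichlet_laplacian E b m VH) k
         \<le> nth_eigenvalue UNIV (special_laplacian E b m) (k + n - r)"
proof -
  interpret standing_weighted_digraph E b m by fact
  interpret positive_weight m by unfold_locales (rule m_pos)
  \<comment> \<open>One free complex coordinate for each vertex of \<open>VH\<close>.\<close>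
  have dim: "vec.dim (supported_in VH) = r"
    using dim_substandard_cart[of VH, where ?'a = complex] assms(4) by (simp add: supported_in_def)
  have sub: "vec.subspace (supported_in VH)"
    by (auto simp: vec.subspace_def supported_in_def)
  have "nth_eigenvalue (supported_in VH) (dirichlet_laplacian E b m VH) k
     \<le> nth_eigenvalue UNIV (special_laplacian E b m) (k + CARD('v) - vec.dim (supported_in VH))"
  proof (rule cauchy_interlacing[OF linear_special_laplacian linear_dirichlet_laplacian sub])
    show "dirichlet_laplacian E b m VH f \<in> supported_in VH" for f
      by (simp add: dirichlet_laplacian_def supported_in_def)
    show "inner_m m (special_laplacian E b m f) g = inner_m m f (special_laplacian E b m g)" for f g
      by (rule special_laplacian_selfadjoint)
    \<comment> \<open>Truncation outside \<open>VH\<close> is invisible to the inner product,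
      because \<open>g\<close> vanishes there.\<close>
    show "inner_m m (dirichlet_laplacian E b m VH f) g = inner_m m (special_laplacian E b m f) g"
      if "g \<in> supported_in VH" for f g
      using that
      by (auto simp: inner_m_def dirichlet_laplacian_def supported_in_def intro!: sum.cong)
    show "1 \<le> k" "k \<le> vec.dim (supported_in VH)"
      using assms by (simp_all add: dim)
  qed
  then show ?thesis using assms(2) by (simp add: dim)
qed

end
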